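(* Let $\mathbf{S}\in\mathbb{Q}[[s_2,s_3,\dots]]$ be the unique formal power series with constant term $1$ satisfying $$0=1-\mathbf{S}+\sum_{k\ge2} s_k\,\mathbf{S}^{k},$$ let $\mathbf{S}_1=s_2+s_3+s_4+\cdots$, and let $\mathbf{G}\in\mathbb{Q}[[s_2,s_3,\dots]]$ be the formal power series with $\mathbf{S}-1=\mathbf{S}_1\,\mathbf{G}$. Fix an integer $a\ge2$. For non-negative integers $m_a,m_{a+1}$, let $\widetilde{G}[m_a,m_{a+1}]$ denote the coefficient of $s_a^{m_a}s_{a+1}^{m_{a+1}}$ (all other variables having exponent $0$) in $\mathbf{G}$, and put $m=m_a+m_{a+1}$. Then $$\widetilde{G}[m_a,m_{a+1}]=\frac{\bigl(am_a+(a+1)(m_{a+1}+1)\bigr)!}{\bigl(a(m+1)+1\bigr)(m+1)\,\bigl((a-1)m_a+a(m_{a+1}+1)\bigr)!\,m_a!\,m_{a+1}!}.$$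
   Context: $\mathbf{S}$ is the series solution $\alpha$ of the general polynomial equation $0=1-\alpha+\sum_{k\ge2}s_k\alpha^k$; here the variable $s_k$ multiplies $\alpha^k$. It is known that $\mathbf{S}-1$ is divisible by $\mathbf{S}_1$ in the ring of formal power series, so the quotient $\mathbf{G}$ (the "Geode series") is a well-defined formal power series. *)

theory Defs
  imports Complex_Main "HOL-Library.Poly_Mapping"
begin

text \<open>
  Formal power series in the (possibly infinitely many) commuting variables indexed by
  \<open>'v\<close>. A monomial is a finitely supported exponent vector, and a series assigns
  an arbitrary coefficient to every monomial.
\<close>

typedef ('v, 'a) mfps = "UNIV :: (('v \<Rightarrow>\<^sub>0 nat) \<Rightarrow> 'a) set"
  morphisms mcoeff Abs_mfps
  by simp

setup_lifting type_definition_mfps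

lemma mfps_eqI: "(\<And>m. mcoeff f m = mcoeff g m) \<Longrightarrow> f = g"
  by transfer auto

definition splits :: "('v \<Rightarrow>\<^sub>0 nat) \<Rightarrow> (('v \<Rightarrow>\<^sub>0 nat) \<times> ('v \<Rightarrow>\<^sub>0 nat)) set" where
  "splits m = {(p, q). p + q = m}"

lemma finite_splits [simp, intro]: "finite (splits m)"
proof -
  let ?B = "{..Max (insert 0 (Poly_Mapping.lookup m ` Poly_Mapping.keys m))}"
  let ?F = "{f. \<forall>x. (x \<in> Poly_Mapping.keys m \<longrightarrow> f x \<in> ?B) \<and> (x \<notin> Poly_Mapping.keys m \<longrightarrow> f x = (0::nat))}"
  have fin: "finite ?F"
    by (rule finite_set_of_finite_funs) auto
  have "Poly_Mapping.lookup p \<in> ?F" if "p + q = m" for p q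
  proof -
    have le: "Poly_Mapping.lookup p x \<le> Poly_Mapping.lookup m x" for x
      using that by (auto simp: lookup_add)
    have "Poly_Mapping.lookup p x \<in> ?B" if "x \<in> Poly_Mapping.keys m" for x
    proof -
      have "Poly_Mapping.lookup m x \<le> Max (insert 0 (Poly_Mapping.lookup m ` Poly_Mapping.keys m))"
        using that by (intro Max_ge) auto
      with le[of x] show ?thesis by simp
    qed
    moreover have "Poly_Mapping.lookup p x = 0" if "x \<notin> Poly_Mapping.keys m" for x
      using le[of x] that by (simp add: in_keys_iff)
    ultimately show ?thesis by blast
  qed
  then have "(\<lambda>(p, q). (Poly_Mapping.lookup p, Poly_Mapping.lookup q)) ` splits m \<subseteq> ?F \<times> ?F"
    by (auto simp: splits_def) (metis add.commute)+
  then have "finite ((\<lambda>(p, q). (Poly_Mapping.lookup p, Poly_Mapping.lookup q)) ` splits m)"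
    using fin finite_subset by blast
  moreover have "inj_on (\<lambda>(p, q). (Poly_Mapping.lookup p, Poly_Mapping.lookup q)) (splits m)"
    by (auto simp: inj_on_def lookup_inject)
  ultimately show ?thesis
    by (rule finite_imageD)
qed

instantiation mfps :: (type, comm_ring_1) comm_ring_1
begin

lift_definition zero_mfps :: "('a, 'b) mfps" is "\<lambda>_. 0" .

lift_definition one_mfps :: "('a, 'b) mfps" is "\<lambda>m. if m = 0 then 1 else 0" .

lift_definition plus_mfps :: "('a, 'b) mfps \<Rightarrow> ('a, 'b) mfps \<Rightarrow> ('a, 'b) mfps"
  is "\<lambda>f g m. f m + g m" .

lift_definition minus_mfps :: "('a, 'b) mfps \<Rightarrow> ('a, 'b) mfps \<Rightarrow> ('a, 'b) mfps"
  is "\<lambda>f g m. f m - g m" .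

lift_definition uminus_mfps :: "('a, 'b) mfps \<Rightarrow> ('a, 'b) mfps"
  is "\<lambda>f m. - f m" .

lift_definition times_mfps :: "('a, 'b) mfps \<Rightarrow> ('a, 'b) mfps \<Rightarrow> ('a, 'b) mfps"
  is "\<lambda>f g m. \<Sum>(p, q)\<in>splits m. f p * g q" .

instance
proof
  fix f g h :: "('a, 'b) mfps"
  show "f + g + h = f + (g + h)" "f + g = g + f" "0 + f = f" "- f + f = 0" "f - g = f + - g"
    by (transfer; simp add: fun_eq_iff algebra_simps)+
  show "(0 :: ('a, 'b) mfps) \<noteq> 1"
    by transfer (auto simp: fun_eq_iff)
  show "(f + g) * h = f * h + g * h"
    by transfer (simp add: fun_eq_iff algebra_simps sum.distrib case_prod_unfold)
  show "f * g = g * f"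
  proof (rule mfps_eqI)
    fix m
    show "mcoeff (f * g) m = mcoeff (g * f) m"
      unfolding times_mfps.rep_eq
      by (rule sum.reindex_bij_witness[where i = "\<lambda>(p, q). (q, p)" and j = "\<lambda>(p, q). (q, p)"])
        (auto simp: splits_def algebra_simps)
  qed
  show "1 * f = f"
  proof (rule mfps_eqI)
    fix m :: "'a \<Rightarrow>\<^sub>0 nat"
    have "mcoeff (1 * f) m = (\<Sum>(p, q)\<in>splits m. (if p = 0 then 1 else 0) * mcoeff f q)"
      by (simp add: times_mfps.rep_eq one_mfps.rep_eq)
    also have "\<dots> = (\<Sum>(p, q)\<in>{(0 :: 'a \<Rightarrow>\<^sub>0 nat, m)}. (if p = 0 then 1 else 0) * mcoeff f q)"
      by (rule sum.mono_neutral_right[OF finite_splits]) (auto simp: splits_def split: if_splits)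
    finally show "mcoeff (1 * f) m = mcoeff f m" by simp
  qed
  show "f * g * h = f * (g * h)"
  proof (rule mfps_eqI)
    fix m :: "'a \<Rightarrow>\<^sub>0 nat"
    let ?L = "SIGMA x:splits m. splits (fst x)"
    let ?R = "SIGMA x:splits m. splits (snd x)"
    have "mcoeff (f * g * h) m =
        (\<Sum>(x, y)\<in>?L. mcoeff f (fst y) * mcoeff g (snd y) * mcoeff h (snd x))"
      by (simp add: times_mfps.rep_eq sum_distrib_right case_prod_unfold sum.Sigma)
    also have "\<dots> =
        (\<Sum>(x, y)\<in>?R. mcoeff f (fst x) * (mcoeff g (fst y) * mcoeff h (snd y)))"
      by (rule sum.reindex_bij_witness[where
            i = "\<lambda>((p, _), (q, r)). ((p + q, r), (p, q))" and
            j = "\<lambda>((_, r), (p, q)). ((p, q + r), (q, r))"])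
        (auto simp: splits_def algebra_simps)
    also have "\<dots> = mcoeff (f * (g * h)) m"
      by (simp add: times_mfps.rep_eq sum_distrib_left case_prod_unfold sum.Sigma)
    finally show "mcoeff (f * g * h) m = mcoeff (f * (g * h)) m" .
  qed
qed

end

lift_definition mvar :: "'v \<Rightarrow> ('v, 'a::comm_ring_1) mfps"
  is "\<lambda>v m. if m = Poly_Mapping.single v 1 then 1 else 0" .

definition mfps_over :: "'v set \<Rightarrow> ('v, 'a::comm_ring_1) mfps set" where
  "mfps_over V = {f. \<forall>m. mcoeff f m \<noteq> 0 \<longrightarrow> Poly_Mapping.keys m \<subseteq> V}"

text \<open>
  The formal, i.e. coefficientwise, sum of a family of series. It is meaningful only if every
  monomial occurs in finitely many members of the family; the lemmas below show this for
  the two families to which the sum is applied.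
\<close>

lift_definition mfps_sum :: "('i \<Rightarrow> ('v, 'a::comm_ring_1) mfps) \<Rightarrow> 'i set \<Rightarrow> ('v, 'a) mfps"
  is "\<lambda>f I m. \<Sum>i | i \<in> I \<and> f i m \<noteq> 0. f i m" .

lemma mfps_sum_locally_finite_mvar_times:
  fixes F :: "'v \<Rightarrow> ('v, 'a::comm_ring_1) mfps"
  shows "finite {k \<in> V. mcoeff (mvar k * F k) m \<noteq> 0}"
proof (rule finite_subset)
  show "{k \<in> V. mcoeff (mvar k * F k) m \<noteq> 0} \<subseteq> Poly_Mapping.keys m"
  proof
    fix k assume "k \<in> {k \<in> V. mcoeff (mvar k * F k) m \<noteq> 0}"
    then have "(\<Sum>x\<in>splits m. mcoeff (mvar k) (fst x) * mcoeff (F k) (snd x)) \<noteq> 0"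
      by (simp add: times_mfps.rep_eq case_prod_unfold)
    then obtain x where x: "x \<in> splits m"
      "mcoeff (mvar k) (fst x) * mcoeff (F k) (snd x) \<noteq> 0"
      by (meson sum.not_neutral_contains_not_neutral)
    then have "fst x = Poly_Mapping.single k 1"
      by (auto simp: mvar.rep_eq split: if_splits)
    with x(1) have "m = Poly_Mapping.single k 1 + snd x"
      by (auto simp: splits_def)
    then have "Poly_Mapping.lookup m k \<noteq> 0"
      by (simp add: lookup_add)
    then show "k \<in> Poly_Mapping.keys m"
      by (simp add: in_keys_iff)
  qed
qed simp

lemma mfps_sum_locally_finite_mvar:
  "finite {k \<in> V. mcoeff (mvar k :: ('v, 'a::comm_ring_1) mfps) m \<noteq> 0}"
  using mfps_sum_locally_finite_mvar_times[of V "\<lambda>_. 1" m] by simp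

end

theory Submission
  imports Defs
begin

text \<open>
  After setting all variables other than \<open>x = s\<^sub>a\<close> and \<open>y = s\<^sub>a\<^sub>+\<^sub>1\<close> to zero, the defining
  equation multiplied by \<open>S\<^sup>r\<close> becomes
  \<open>S\<^bsup>r+1\<^esup> = S\<^bsup>r\<^esup> + x S\<^bsup>r+a\<^esup> + y S\<^bsup>r+a+1\<^esup>\<close>. This recurrence determines the coefficients of all
  powers of \<open>S\<close>, and the closed form predicted by Lagrange inversion satisfies it, so no general
  inversion theorem is required. The equation \<open>S - 1 = (x + y) G\<close> then reads
  \<open>S[i,j] = G[i-1,j] + G[i,j-1]\<close>, which determines \<open>G\<close> by induction on \<open>i\<close>.
\<close>

section \<open>Products with a variable and formal sums of such products\<close>

lemma mcoeff_mvar_times_add: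
  "mcoeff (mvar k * F) (Poly_Mapping.single k 1 + m) = mcoeff F m"
proof -
  have "mcoeff (mvar k * F) (Poly_Mapping.single k 1 + m) =
      (\<Sum>(p, q)\<in>splits (Poly_Mapping.single k 1 + m).
        (if p = Poly_Mapping.single k 1 then 1 else 0) * mcoeff F q)"
    by (simp add: times_mfps.rep_eq mvar.rep_eq)
  also have "\<dots> = (\<Sum>(p, q)\<in>{(Poly_Mapping.single k (1 :: nat), m)}.
        (if p = Poly_Mapping.single k 1 then 1 else 0) * mcoeff F q)"
    by (rule sum.mono_neutral_right[OF finite_splits]) (auto simp: splits_def split: if_splits)
  finally show ?thesis by simp
qed

lemma mcoeff_mvar_times_eq_0:
  assumes "k \<notin> Poly_Mapping.keys m"
  shows "mcoeff (mvar k * F) m = 0"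
proof -
  have "mcoeff (mvar k) p = (0 :: 'b)" if "p + q = m" for p q
    using that assms by (auto simp: mvar.rep_eq in_keys_iff lookup_add)
  then show ?thesis
    unfolding times_mfps.rep_eq by (intro sum.neutral) (auto simp: splits_def)
qed

text \<open>A variable contributes at \<open>m\<close> only if it divides \<open>m\<close>. Allowing
  any finite superset \<open>K\<close> of the keys lets one index set serve all factors of a
  monomial at once.\<close>

lemma mcoeff_mfps_sum_mvar_times:
  assumes "finite K" "Poly_Mapping.keys m \<subseteq> K"
  shows "mcoeff (mfps_sum (\<lambda>k. mvar k * H k) V) m = (\<Sum>k\<in>V \<inter> K. mcoeff (mvar k * H k) m)"
  unfolding mfps_sum.rep_eq
  by (rule sum.mono_neutral_left) (use assms mcoeff_mvar_times_eq_0 in fastforce)+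

text \<open>The formal sum may be infinite, so distributivity is checked coefficientwise: every
  factor of \<open>m\<close> has its keys among those of \<open>m\<close>, which leaves an
  interchange of two finite sums.\<close>

lemma times_mfps_sum_mvar_times:
  "F * mfps_sum (\<lambda>k. mvar k * H k) V = mfps_sum (\<lambda>k. mvar k * (F * H k)) V"
proof (rule mfps_eqI)
  fix m :: "'a \<Rightarrow>\<^sub>0 nat"
  let ?K = "Poly_Mapping.keys m"
  have keys: "Poly_Mapping.keys q \<subseteq> ?K" if "(p, q) \<in> splits m" for p q
    using that by (auto simp: splits_def in_keys_iff lookup_add)
  have "mcoeff (F * mfps_sum (\<lambda>k. mvar k * H k) V) m =
      (\<Sum>(p, q)\<in>splits m. mcoeff F p * (\<Sum>k\<in>V \<inter> ?K. mcoeff (mvar k * H k) q))"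
    unfolding times_mfps.rep_eq[of F]
    by (intro sum.cong refl) (auto simp: mcoeff_mfps_sum_mvar_times[OF _ keys])
  also have "\<dots> = (\<Sum>k\<in>V \<inter> ?K. mcoeff (F * (mvar k * H k)) m)"
    unfolding times_mfps.rep_eq[of F]
    by (simp add: sum_distrib_left case_prod_unfold sum.swap[of _ "V \<inter> ?K"])
  also have "\<dots> = mcoeff (mfps_sum (\<lambda>k. mvar k * (F * H k)) V) m"
    by (subst mcoeff_mfps_sum_mvar_times[of ?K]) (simp_all add: mult.left_commute)
  finally show "mcoeff (F * mfps_sum (\<lambda>k. mvar k * H k) V) m =
      mcoeff (mfps_sum (\<lambda>k. mvar k * (F * H k)) V) m" .
qed

section \<open>Coefficients at monomials in two adjacent variables\<close>

definition bimonom :: "nat \<Rightarrow> nat \<Rightarrow> nat \<Rightarrow> (nat \<Rightarrow>\<^sub>0 nat)" where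
  "bimonom a i j = Poly_Mapping.single a i + Poly_Mapping.single (a + 1) j"

lemma bimonom_0_0: "bimonom a 0 0 = 0"
  by (simp add: bimonom_def)

lemma bimonom_eq_0_iff: "bimonom a i j = 0 \<longleftrightarrow> i = 0 \<and> j = 0"
proof
  assume "bimonom a i j = 0"
  then have "Poly_Mapping.lookup (bimonom a i j) a = 0"
      "Poly_Mapping.lookup (bimonom a i j) (a + 1) = 0" by simp_all
  then show "i = 0 \<and> j = 0" by (simp add: bimonom_def lookup_add lookup_single)
qed (simp add: bimonom_def)

lemma mcoeff_mvar_times_bimonom:
  "mcoeff (mvar a * F) (bimonom a i j) = (if i = 0 then 0 else mcoeff F (bimonom a (i - 1) j))"
proof (cases i)
  case 0
  then show ?thesis
    by (simp add: mcoeff_mvar_times_eq_0 bimonom_def in_keys_iff lookup_single)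
next
  case (Suc i')
  then have "bimonom a i j = Poly_Mapping.single a 1 + bimonom a i' j"
    by (simp add: bimonom_def add.assoc[symmetric] single_add[symmetric])
  then show ?thesis using Suc mcoeff_mvar_times_add[of a F] by simp
qed

lemma mcoeff_mvar_Suc_times_bimonom:
  "mcoeff (mvar (a + 1) * F) (bimonom a i j) =
    (if j = 0 then 0 else mcoeff F (bimonom a i (j - 1)))"
proof (cases j)
  case 0
  then show ?thesis
    by (simp add: mcoeff_mvar_times_eq_0 bimonom_def in_keys_iff lookup_single)
next
  case (Suc j')
  then have "bimonom a i j = Poly_Mapping.single (a + 1) 1 + bimonom a i j'"
    by (simp add: bimonom_def add.left_commute single_add[symmetric])
  then show ?thesis using Suc mcoeff_mvar_times_add[of "a + 1" F] by simp
qed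

text \<open>This replaces setting the other variables to zero: none of them divides the monomial, so
  two terms survive.\<close>

lemma mcoeff_mfps_sum_bimonom:
  assumes "a \<in> V" "a + 1 \<in> V"
  shows "mcoeff (mfps_sum (\<lambda>k. mvar k * H k) V) (bimonom a i j) =
    (if i = 0 then 0 else mcoeff (H a) (bimonom a (i - 1) j)) +
    (if j = 0 then 0 else mcoeff (H (a + 1)) (bimonom a i (j - 1)))"
proof -
  have "Poly_Mapping.keys (bimonom a i j) \<subseteq> {a, a + 1}"
    by (auto simp: bimonom_def in_keys_iff lookup_add lookup_single when_def split: if_splits)
  moreover have "V \<inter> {a, a + 1} = {a, a + 1}" using assms by auto
  ultimately have "mcoeff (mfps_sum (\<lambda>k. mvar k * H k) V) (bimonom a i j) =
      mcoeff (mvar a * H a) (bimonom a i j) + mcoeff (mvar (a + 1) * H (a + 1)) (bimonom a i j)"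
    by (simp add: mcoeff_mfps_sum_mvar_times[of "{a, a + 1}"])
  then show ?thesis
    by (simp only: mcoeff_mvar_times_bimonom mcoeff_mvar_Suc_times_bimonom)
qed

section \<open>Coefficients of the powers of the series solution\<close>

text \<open>Lagrange inversion's value for the coefficient of \<open>x^i y^j\<close> in
  \<open>S^r\<close>. At \<open>r = i = j = 0\<close> it gives 0 instead of 1, so that case is
  excluded below.\<close>

definition lagrange_coeff :: "nat \<Rightarrow> nat \<Rightarrow> nat \<Rightarrow> nat \<Rightarrow> rat" where
  "lagrange_coeff a r i j = of_nat r * fact (a * i + (a + 1) * j + r - 1) /
    (fact ((a - 1) * i + a * j + r) * fact i * fact j)"

lemma lagrange_coeff_recurrence:
  assumes "a \<ge> 1" "i + j > 0"
  shows "lagrange_coeff a (Suc r) i j = lagrange_coeff a r i j +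
    (if i = 0 then 0 else lagrange_coeff a (r + a) (i - 1) j) +
    (if j = 0 then 0 else lagrange_coeff a (r + (a + 1)) i (j - 1))"
proof -
  obtain b where a: "a = Suc b" using assms(1) by (cases a) auto
  define N where "N = a * i + (a + 1) * j + r - 1"
  define D where "D = (a - 1) * i + a * j + r"
  \<comment> \<open>Since \<open>i + j > 0\<close>, the truncated subtraction in \<open>N\<close> is
    exact.\<close>
  have N: "Suc N = a * i + (a + 1) * j + r"
    using assms by (cases i; cases j) (auto simp: N_def a)
  have D: "Suc D + i + j = Suc (Suc N)"
    unfolding N D_def by (simp add: a algebra_simps)
  \<comment> \<open>Each of the four terms is an integer multiple of \<open>?q\<close>. The factors
    \<open>i\<close> and \<open>j\<close> that appear also absorb the default value 0 at
    \<open>i = 0\<close> or \<open>j = 0\<close>.\<close>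
  let ?q = "fact N / (fact (Suc D) * fact i * fact j) :: rat"
  have 1: "lagrange_coeff a (Suc r) i j = of_nat (Suc r) * of_nat (Suc N) * ?q"
  proof -
    have "a * i + (a + 1) * j + Suc r - 1 = Suc N" "(a - 1) * i + a * j + Suc r = Suc D"
      using N by (simp_all add: D_def)
    then show ?thesis unfolding lagrange_coeff_def by (simp only: fact_Suc) simp
  qed
  have 2: "lagrange_coeff a r i j = of_nat r * of_nat (Suc D) * ?q"
    unfolding lagrange_coeff_def N_def[symmetric] D_def[symmetric]
      by (simp add: field_simps del: of_nat_Suc)
  have 3: "(if i = 0 then 0 else lagrange_coeff a (r + a) (i - 1) j) = of_nat (r + a) * of_nat i * ?q"
  proof (cases i)
    case (Suc i')
    have "a * i' + (a + 1) * j + (r + a) - 1 = N" "(a - 1) * i' + a * j + (r + a) = Suc D"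
      by (simp_all add: N_def D_def Suc a algebra_simps)
    then show ?thesis unfolding lagrange_coeff_def using Suc
      by (simp add: divide_simps del: of_nat_Suc of_nat_add)
  qed simp
  have 4: "(if j = 0 then 0 else lagrange_coeff a (r + (a + 1)) i (j - 1)) =
      of_nat (r + a + 1) * of_nat j * ?q"
  proof (cases j)
    case (Suc j')
    have "a * i + (a + 1) * j' + (r + (a + 1)) - 1 = N" "(a - 1) * i + a * j' + (r + (a + 1)) = Suc D"
      by (simp_all add: N_def D_def Suc a algebra_simps)
    then show ?thesis unfolding lagrange_coeff_def using Suc
      by (simp add: divide_simps add.assoc del: of_nat_Suc of_nat_add)
  qed simp
  \<comment> \<open>This is the recurrence with \<open>?q\<close> cancelled.\<close>
  have "Suc r * Suc N = r * Suc D + (r + a) * i + (r + a + 1) * j"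
    unfolding N D_def by (simp add: a algebra_simps)
  then have "(of_nat (Suc r) * of_nat (Suc N) :: rat) =
      of_nat r * of_nat (Suc D) + of_nat (r + a) * of_nat i + of_nat (r + a + 1) * of_nat j"
    by (metis of_nat_add of_nat_mult)
  then show ?thesis unfolding 1 2 3 4 by (simp only: distrib_right)
qed

text \<open>The recurrence lowers the degree \<open>i + j\<close> but raises the exponent by
  \<open>a\<close> or \<open>a + 1\<close>. Hence the outer induction is on the degree, for all
  exponents at once, with an inner induction on \<open>r\<close>.\<close>

lemma mcoeff_power_bimonom:
  fixes S :: "(nat, rat) mfps"
  assumes eq: "S = 1 + mfps_sum (\<lambda>k. mvar k * S ^ k) V"
    and V: "a \<in> V" "a + 1 \<in> V" and a: "a \<ge> 1"
  shows "r + i + j > 0 \<Longrightarrow> mcoeff (S ^ r) (bimonom a i j) = lagrange_coeff a r i j"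
proof (induction "i + j" arbitrary: r i j rule: less_induct)
  case less
  have rec: "mcoeff (S ^ Suc r) (bimonom a i j) = mcoeff (S ^ r) (bimonom a i j) +
      ((if i = 0 then 0 else mcoeff (S ^ (r + a)) (bimonom a (i - 1) j)) +
      (if j = 0 then 0 else mcoeff (S ^ (r + (a + 1))) (bimonom a i (j - 1))))" for r i j
  proof -
    have "S ^ Suc r = S ^ r * (1 + mfps_sum (\<lambda>k. mvar k * S ^ k) V)"
      using eq by (simp add: mult.commute)
    also have "\<dots> = S ^ r + mfps_sum (\<lambda>k. mvar k * S ^ (r + k)) V"
      by (simp add: distrib_left times_mfps_sum_mvar_times power_add)
    finally show ?thesis
      by (simp only: plus_mfps.rep_eq mcoeff_mfps_sum_bimonom[OF V])
  qed
  show ?case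
  proof (cases "i + j = 0")
    case True
    \<comment> \<open>At \<open>i = j = 0\<close> the recurrence says that \<open>S ^ Suc r\<close>
      and \<open>S ^ r\<close> have the same constant term.\<close>
    have one: "mcoeff (S ^ r) 0 = 1" for r
      by (induction r) (use rec[of _ 0 0] in \<open>simp_all add: bimonom_0_0 one_mfps.rep_eq\<close>)
    with True less.prems show ?thesis
      by (cases r) (simp_all add: bimonom_0_0 lagrange_coeff_def del: power_Suc)
  next
    case False
    show ?thesis
    proof (induction r)
      case 0
      then show ?case using False
        by (simp add: one_mfps.rep_eq bimonom_eq_0_iff lagrange_coeff_def)
    next
      case (Suc r)
      \<comment> \<open>As \<open>a \<ge> 1\<close>, the new exponent is positive and the excluded
        case cannot arise.\<close>
      have "mcoeff (S ^ (r + a)) (bimonom a (i - 1) j) = lagrange_coeff a (r + a) (i - 1) j"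
        if "i \<noteq> 0" using that a by (intro less.hyps) auto
      moreover have "mcoeff (S ^ (r + (a + 1))) (bimonom a i (j - 1)) =
          lagrange_coeff a (r + (a + 1)) i (j - 1)"
        if "j \<noteq> 0" using that a by (intro less.hyps) auto
      ultimately show ?case
        using rec[of r i j] Suc.IH lagrange_coeff_recurrence[OF a, of i j r] False by auto
    qed
  qed
qed

section \<open>Coefficients of the Geode series\<close>

definition geode_coeff :: "nat \<Rightarrow> nat \<Rightarrow> nat \<Rightarrow> rat" where
  "geode_coeff a i j = fact (a * i + (a + 1) * (j + 1)) /
    (of_nat (a * (i + j + 1) + 1) * of_nat (i + j + 1) *
      fact ((a - 1) * i + a * (j + 1)) * fact i * fact j)"

text \<open>The factor \<open>C\<close> depends only on \<open>i + j\<close>, so both Geode terms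
  share it. With \<open>N = a * n + j + 1\<close> and \<open>D = a * n - i\<close>, the cross terms
  in \<open>Suc N * i + Suc D * Suc j\<close> cancel and leave exactly \<open>C\<close>.\<close>

lemma lagrange_coeff_eq_geode_coeff:
  assumes "a \<ge> 1"
  shows "lagrange_coeff a 1 i (Suc j) =
    (if i = 0 then 0 else geode_coeff a (i - 1) (Suc j)) + geode_coeff a i j"
proof -
  obtain b where a: "a = Suc b" using assms by (cases a) auto
  define N where "N = a * i + (a + 1) * Suc j"
  define D where "D = (a - 1) * i + a * Suc j"
  define n where "n = i + j + 1"
  define C where "C = (of_nat (a * n + 1) * of_nat n :: rat)"
  have C: "C \<noteq> 0" unfolding C_def n_def by (simp del: of_nat_Suc of_nat_add)
  let ?q = "fact N / (fact (Suc D) * fact i * fact (Suc j)) :: rat"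
  have 1: "lagrange_coeff a 1 i (Suc j) = ?q"
    unfolding lagrange_coeff_def N_def D_def by simp
  have 2: "geode_coeff a i j = of_nat (Suc D) * of_nat (Suc j) / C * ?q"
  proof -
    have "geode_coeff a i j = fact N / (C * fact D * fact i * fact j)"
      unfolding geode_coeff_def C_def N_def D_def n_def by simp
    then show ?thesis using C by (simp add: divide_simps del: of_nat_Suc)
  qed
  have 3: "(if i = 0 then 0 else geode_coeff a (i - 1) (Suc j)) = of_nat (Suc N) * of_nat i / C * ?q"
  proof (cases i)
    case (Suc i')
    have "a * i' + (a + 1) * (Suc j + 1) = Suc N" "(a - 1) * i' + a * (Suc j + 1) = Suc D"
        "i' + Suc j + 1 = n"
      by (simp_all add: N_def D_def n_def Suc a algebra_simps)
    then have "geode_coeff a i' (Suc j) = fact (Suc N) / (C * fact (Suc D) * fact i' * fact (Suc j))"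
      unfolding geode_coeff_def C_def by simp
    then show ?thesis using C Suc by (simp add: divide_simps del: of_nat_Suc)
  qed simp
  have "(a * n + 1) * n = Suc N * i + Suc D * Suc j"
    unfolding N_def D_def n_def by (simp add: a algebra_simps)
  then have "C = of_nat (Suc N) * of_nat i + of_nat (Suc D) * of_nat (Suc j)"
    unfolding C_def by (metis of_nat_add of_nat_mult)
  then have "of_nat (Suc N) * of_nat i / C + of_nat (Suc D) * of_nat (Suc j) / C = 1"
    using C by (simp add: add_divide_distrib[symmetric] del: of_nat_Suc)
  then show ?thesis unfolding 1 2 3 by (simp only: distrib_right[symmetric] mult_1)
qed

theorem theorem2p1:
  fixes S S1 G :: "(nat, rat) mfps"
    and a m_a m_a1 m :: nat
  assumes "S \<in> mfps_over {2..}"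
    and "mcoeff S 0 = 1"
    and "0 = 1 - S + mfps_sum (\<lambda>k. mvar k * S ^ k) {2..}"
    and "S1 = mfps_sum mvar {2..}"
    and "G \<in> mfps_over {2..}"
    and "S - 1 = S1 * G"
    and "a \<ge> 2"
    and "m = m_a + m_a1"
  shows "mcoeff G (Poly_Mapping.single a m_a + Poly_Mapping.single (a + 1) m_a1) =
    fact (a * m_a + (a + 1) * (m_a1 + 1)) /
    (of_nat (a * (m + 1) + 1) * of_nat (m + 1) *
      fact ((a - 1) * m_a + a * (m_a1 + 1)) * fact m_a * fact m_a1)"
proof -
  have V: "a \<in> {2..}" "a + 1 \<in> {2..}" and a: "a \<ge> 1" using assms(7) by auto
  have S: "S = 1 + mfps_sum (\<lambda>k. mvar k * S ^ k) {2..}"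
    using assms(3) by (simp add: algebra_simps)
  \<comment> \<open>Absorbing \<open>G\<close> into the formal sum makes
    \<open>mcoeff_mfps_sum_bimonom\<close> applicable.\<close>
  have G: "S = 1 + mfps_sum (\<lambda>k. mvar k * G) {2..}"
    using assms(4,6) times_mfps_sum_mvar_times[of G "\<lambda>_. 1" "{2..}"]
    by (simp add: algebra_simps)
  \<comment> \<open>The second exponent \<open>Suc j\<close> is nonzero, so the constant 1 drops out
    and the term with \<open>G\<close> at \<open>(i, j)\<close> is always present.\<close>
  have step: "lagrange_coeff a 1 i (Suc j) =
      (if i = 0 then 0 else mcoeff G (bimonom a (i - 1) (Suc j))) + mcoeff G (bimonom a i j)" for i j
  proof -
    have "lagrange_coeff a 1 i (Suc j) = mcoeff S (bimonom a i (Suc j))"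
      using mcoeff_power_bimonom[OF S V a, of 1 i "Suc j"] by simp
    also have "\<dots> = mcoeff (1 + mfps_sum (\<lambda>k. mvar k * G) {2..}) (bimonom a i (Suc j))"
      using G by simp
    finally show ?thesis
      by (simp only: plus_mfps.rep_eq one_mfps.rep_eq mcoeff_mfps_sum_bimonom[OF V]
          bimonom_eq_0_iff) simp
  qed
  \<comment> \<open>Solving \<open>step\<close> for the coefficient at \<open>(i, j)\<close> calls
    for the one at \<open>(i - 1, j + 1)\<close>, so \<open>j\<close> must stay arbitrary.\<close>
  have "mcoeff G (bimonom a i j) = geode_coeff a i j" for i j
  proof (induction i arbitrary: j)
    case 0
    show ?case using step[of 0 j] lagrange_coeff_eq_geode_coeff[OF a, of 0 j] by simp
  next
    case (Suc i)
    show ?case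
      using step[of "Suc i" j] lagrange_coeff_eq_geode_coeff[OF a, of "Suc i" j] Suc.IH by simp
  qed
  then show ?thesis
    unfolding bimonom_def geode_coeff_def assms(8) by blast
qed

end
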